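(* Let $L=L_1\cup\cdots\cup L_\ell$ be an oriented ordered link. For every component signature $\tau\in\{0,1\}^\ell$, the signature module $A_\tau(L)$ is obtained from the multivariable Alexander module $M_A(L)$ by setting $t_k=(-1)^{\tau_k}$ on each component $L_k$. That is, if $\phi_\tau:\Lambda_\ell\to\mathbb{Z}$ is the ring homomorphism with $\phi_\tau(t_k)=(-1)^{\tau_k}$ for $k=1,\ldots,\ell$, then there is an isomorphism of abelian groups \[ A_\tau(L)\cong \mathbb{Z}_{\phi_\tau}\otimes_{\Lambda_\ell} M_A(L). \]
   Context: Diagram conventions. Let $D$ be a diagram of an oriented ordered link $L=L_1\cup\cdots\cup L_\ell$. An arc of $D$ is a maximal piece of the diagram running from one undercrossing to the next; a component with no undercrossings counts as a single arc. Let $m$ be the number of arcs and $k$ the number of crossings. At each crossing let $a$ be the over-arc; of the two under-arcs, the source $b$ is the one lying to the right of the oriented over-arc and the target $c$ is the one lying to its left (so at a positive crossing the source is the incoming under-arc and the target is the outgoing one, and at a negative crossing the roles are reversed). Component signature. A component signature is a vector $\tau=(\tau_1,\ldots,\tau_\ell)\in\{0,1\}^\ell$. An arc lying on $L_j$ is said to have type $\tau_j$. Signature matrix and module. Assign a variable $x_i$ to each arc of $D$. At a crossing with over-arc $a$ of type $\delta$ and under-arcs $b$ (source), $c$ (target), both of type $\epsilon$, form the integer linear relation $2\epsilon x_a+(-1)^\delta x_b-x_c=0$ (coefficients are added if some of $a,b,c$ coincide). The matrix $M_\tau(D)\in\operatorname{Mat}_{k\times m}(\mathbb{Z})$ has one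 row for each crossing, consisting of the coefficients of this relation. The signature module is $A_\tau(D)=\mathbb{Z}^m/\operatorname{rowspan}_{\mathbb{Z}}(M_\tau(D))$; its isomorphism class is independent of the diagram $D$ of $L$ and is denoted $A_\tau(L)$. Multivariable Alexander module. Let $\Lambda_\ell=\mathbb{Z}[t_1^{\pm1},\ldots,t_\ell^{\pm1}]$. $M_A(L)$ is the $\Lambda_\ell$-module generated by elements $e_a$, one for each arc $a$ of $D$, with one relation for each crossing: if the under-arcs $b$ (source) and $c$ (target) lie on $L_i$ and the over-arc $a$ lies on $L_j$, the relation is $(1-t_i)e_a+t_je_b-e_c=0$. $\mathbb{Z}_{\phi_\tau}$ denotes $\mathbb{Z}$ regarded as a $\Lambda_\ell$-module via $\phi_\tau$. *)

theory Defs
  imports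
    "HOL-Analysis.Analysis"
    "HOL-Algebra.Module"
    "HOL-Algebra.IntRing"
    "HOL-Algebra.Generated_Groups"
    "HOL-Algebra.Free_Abelian_Groups"
begin

section \<open>Oriented ordered links and their diagrams\<close>

text \<open>
  Euclidean 3-space is \<^typ>\<open>complex \<times> real\<close>, a point being given by its projection to the
  plane and its height above it. A family of closed oriented curves \<open>L 1, \<dots>, L l\<close> is given by
  parametrizations of period 1; the values of \<open>L\<close> at other indices are irrelevant.
\<close>

type_synonym curves = "nat \<Rightarrow> real \<Rightarrow> complex \<times> real"

definition oriented_link :: "nat \<Rightarrow> curves \<Rightarrow> bool" where
  "oriented_link l L \<longleftrightarrow>
     (\<forall>i\<in>{1..l}. L i C1_differentiable_on UNIV \<and>
        (\<forall>t. vector_derivative (L i) (at t) \<noteq> 0 \<and> L i (t + 1) = L i t)) \<and>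
     (\<forall>i\<in>{1..l}. \<forall>j\<in>{1..l}. \<forall>s\<in>{0..<1}. \<forall>t\<in>{0..<1}. L i s = L j t \<longrightarrow> i = j \<and> s = t)"

text \<open>
  Equivalence of oriented ordered links: an ambient isotopy takes each component to the component
  with the same index, up to an orientation-preserving reparametrization \<open>\<rho>\<close> of the circle.
\<close>

definition link_isotopic :: "nat \<Rightarrow> curves \<Rightarrow> curves \<Rightarrow> bool" where
  "link_isotopic l L L' \<longleftrightarrow>
     (\<exists>H :: real \<Rightarrow> complex \<times> real \<Rightarrow> complex \<times> real.
        continuous_on ({0..1} \<times> UNIV) (\<lambda>(u, x). H u x) \<and>
        (\<forall>u\<in>{0..1}. \<exists>g. homeomorphism UNIV UNIV (H u) g) \<and>
        H 0 = id \<and>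
        (\<forall>i\<in>{1..l}. \<exists>\<rho> :: real \<Rightarrow> real.
           continuous_on UNIV \<rho> \<and> strict_mono \<rho> \<and> (\<forall>t. \<rho> (t + 1) = \<rho> t + 1) \<and>
           (\<forall>t. H 1 (L i t) = L' i (\<rho> t))))"

definition proj :: "curves \<Rightarrow> nat \<Rightarrow> real \<Rightarrow> complex" where
  "proj D i t = fst (D i t)"

definition height :: "curves \<Rightarrow> nat \<Rightarrow> real \<Rightarrow> real" where
  "height D i t = snd (D i t)"

definition velocity :: "curves \<Rightarrow> nat \<Rightarrow> real \<Rightarrow> complex" where
  "velocity D i t = vector_derivative (proj D i) (at t)"

text \<open>
  The number \<open>plane_det v w\<close> is the determinant of the plane vectors \<open>v, w\<close>; it is positive
  iff \<open>w\<close> points to the left of the directed line spanned by \<open>v\<close>.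
\<close>

definition plane_det :: "complex \<Rightarrow> complex \<Rightarrow> real" where
  "plane_det v w = Re v * Im w - Im v * Re w"

text \<open>
  A diagram is the projection of a link in general position, the heights recording which strand
  passes over at a double point: the projection is an immersion with finitely many multiple
  points, all of which are transverse double points.
\<close>

definition link_diagram :: "nat \<Rightarrow> curves \<Rightarrow> bool" where
  "link_diagram l D \<longleftrightarrow>
     oriented_link l D \<and>
     (\<forall>i\<in>{1..l}. \<forall>t. velocity D i t \<noteq> 0) \<and>
     finite {z. \<exists>i\<in>{1..l}. \<exists>j\<in>{1..l}. \<exists>s\<in>{0..<1}. \<exists>t\<in>{0..<1}.
       (i, s) \<noteq> (j, t) \<and> proj D i s = z \<and> proj D j t = z} \<and>
     (\<forall>z. finite {(i, t). i \<in> {1..l} \<and> t \<in> {0..<1} \<and> proj D i t = z} \<and>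
          card {(i, t). i \<in> {1..l} \<and> t \<in> {0..<1} \<and> proj D i t = z} \<le> 2) \<and>
     (\<forall>i\<in>{1..l}. \<forall>j\<in>{1..l}. \<forall>s\<in>{0..<1}. \<forall>t\<in>{0..<1}.
       (i, s) \<noteq> (j, t) \<and> proj D i s = proj D j t \<longrightarrow>
       plane_det (velocity D i s) (velocity D j t) \<noteq> 0)"

definition diagram_of :: "nat \<Rightarrow> curves \<Rightarrow> curves \<Rightarrow> bool" where
  "diagram_of l D L \<longleftrightarrow> link_diagram l D \<and> link_isotopic l L D"


section \<open>Crossings and arcs\<close>

text \<open>
  A crossing \<open>((i, s), (j, t))\<close> consists of the parameters \<open>(i, s)\<close> of the over-strand and
  \<open>(j, t)\<close> of the under-strand.
\<close>

type_synonym crossing = "(nat \<times> real) \<times> (nat \<times> real)"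

definition crossings :: "nat \<Rightarrow> curves \<Rightarrow> crossing set" where
  "crossings l D = {((i, s), (j, t)) | i s j t.
     i \<in> {1..l} \<and> j \<in> {1..l} \<and> s \<in> {0..<1} \<and> t \<in> {0..<1} \<and>
     proj D i s = proj D j t \<and> height D i s > height D j t}"

definition undercrossing :: "nat \<Rightarrow> curves \<Rightarrow> nat \<Rightarrow> real \<Rightarrow> bool" where
  "undercrossing l D j t \<longleftrightarrow>
     (\<exists>i\<in>{1..l}. \<exists>s. proj D i s = proj D j t \<and> height D i s > height D j t)"

text \<open>
  Arcs are represented by their sets of parameters \<open>(i, t)\<close> with \<open>t\<close> ranging over all of the reals,
  so that these sets are invariant under \<open>t \<mapsto> t + 1\<close>; the undercrossings bounding an arc are not
  included. Two parameters lie on the same arc iff, modulo the period, no undercrossing separates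
  them. A component without undercrossings thus gives exactly one arc.
\<close>

type_synonym arc = "(nat \<times> real) set"

definition arc_through :: "nat \<Rightarrow> curves \<Rightarrow> nat \<Rightarrow> real \<Rightarrow> arc" where
  "arc_through l D i t =
     {(i, s) | s. \<exists>n::int. \<forall>u\<in>closed_segment t (s + of_int n). \<not> undercrossing l D i u}"

definition arcs :: "nat \<Rightarrow> curves \<Rightarrow> arc set" where
  "arcs l D = {arc_through l D i t | i t. i \<in> {1..l} \<and> \<not> undercrossing l D i t}"

definition arc_component :: "arc \<Rightarrow> nat" where
  "arc_component a = (THE i. \<forall>p\<in>a. fst p = i)"

definition incoming_arc :: "nat \<Rightarrow> curves \<Rightarrow> nat \<Rightarrow> real \<Rightarrow> arc" where
  "incoming_arc l D j t = (THE a. a \<in> arcs l D \<and> (\<forall>\<^sub>F u in at_left t. (j, u) \<in> a))"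

definition outgoing_arc :: "nat \<Rightarrow> curves \<Rightarrow> nat \<Rightarrow> real \<Rightarrow> arc" where
  "outgoing_arc l D j t = (THE a. a \<in> arcs l D \<and> (\<forall>\<^sub>F u in at_right t. (j, u) \<in> a))"

text \<open>
  At a positive crossing the under-strand passes from the right of the over-strand to its left.
\<close>

definition positive_crossing :: "curves \<Rightarrow> crossing \<Rightarrow> bool" where
  "positive_crossing D = (\<lambda>((i, s), (j, t)). plane_det (velocity D i s) (velocity D j t) > 0)"

definition over_arc :: "nat \<Rightarrow> curves \<Rightarrow> crossing \<Rightarrow> arc" where
  "over_arc l D = (\<lambda>((i, s), (j, t)). arc_through l D i s)"

definition source_arc :: "nat \<Rightarrow> curves \<Rightarrow> crossing \<Rightarrow> arc" where
  "source_arc l D = (\<lambda>((i, s), (j, t)).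
     if positive_crossing D ((i, s), (j, t)) then incoming_arc l D j t else outgoing_arc l D j t)"

definition target_arc :: "nat \<Rightarrow> curves \<Rightarrow> crossing \<Rightarrow> arc" where
  "target_arc l D = (\<lambda>((i, s), (j, t)).
     if positive_crossing D ((i, s), (j, t)) then outgoing_arc l D j t else incoming_arc l D j t)"


section \<open>Signature modules\<close>

definition component_signatures :: "nat \<Rightarrow> (nat \<Rightarrow> nat) set" where
  "component_signatures l = {1..l} \<rightarrow>\<^sub>E {0, 1}"

definition arc_type :: "(nat \<Rightarrow> nat) \<Rightarrow> arc \<Rightarrow> nat" where
  "arc_type \<tau> a = \<tau> (arc_component a)"

text \<open>
  The matrix is indexed by crossings and arcs themselves: \<open>signature_matrix l \<tau> D x\<close> is the row
  of the crossing \<open>x\<close>, an element of the free abelian group on the arcs.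
\<close>

definition signature_matrix :: "nat \<Rightarrow> (nat \<Rightarrow> nat) \<Rightarrow> curves \<Rightarrow> crossing \<Rightarrow> (arc \<Rightarrow>\<^sub>0 int)" where
  "signature_matrix l \<tau> D x =
     (let a = over_arc l D x; b = source_arc l D x; c = target_arc l D x;
          \<delta> = arc_type \<tau> a; \<epsilon> = arc_type \<tau> b
      in Poly_Mapping.single a (2 * int \<epsilon>) + Poly_Mapping.single b ((-1) ^ \<delta>)
           - Poly_Mapping.single c 1)"

definition signature_module :: "nat \<Rightarrow> (nat \<Rightarrow> nat) \<Rightarrow> curves \<Rightarrow> (arc \<Rightarrow>\<^sub>0 int) set monoid" where
  "signature_module l \<tau> D =
     free_Abelian_group (arcs l D) Mod
       generate (free_Abelian_group (arcs l D)) (signature_matrix l \<tau> D ` crossings l D)"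


section \<open>Modules over Laurent polynomial rings\<close>

text \<open>
  A Laurent polynomial maps exponent vectors, which are finitely supported functions from indices
  to integers, to coefficients; multiplication is convolution.
\<close>

type_synonym laurent = "(nat \<Rightarrow>\<^sub>0 int) \<Rightarrow>\<^sub>0 int"

definition laurent_ring :: "nat \<Rightarrow> laurent ring" where
  "laurent_ring l =
     \<lparr>carrier = {p. \<forall>e\<in>Poly_Mapping.keys p. Poly_Mapping.keys e \<subseteq> {1..l}},
      mult = (*), one = 1, ring.zero = 0, add = (+)\<rparr>"

definition laurent_var :: "nat \<Rightarrow> laurent" where
  "laurent_var k = Poly_Mapping.single (Poly_Mapping.single k 1) 1"

text \<open>
  Module records extend ring records; the fields \<open>mult\<close> and \<open>one\<close> play no role for modules.
\<close>

definition free_laurent_module :: "nat \<Rightarrow> 'a set \<Rightarrow> (laurent, 'a \<Rightarrow>\<^sub>0 laurent) module" where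
  "free_laurent_module l S =
     \<lparr>carrier = {f. Poly_Mapping.keys f \<subseteq> S \<and>
        (\<forall>a. Poly_Mapping.lookup f a \<in> carrier (laurent_ring l))},
      mult = undefined, one = undefined, ring.zero = 0, add = (+),
      smult = (\<lambda>p. Poly_Mapping.map (\<lambda>q. p * q))\<rparr>"

definition generated_submodule ::
    "('r, 'k) ring_scheme \<Rightarrow> ('r, 'm, 'n) module_scheme \<Rightarrow> 'm set \<Rightarrow> 'm set" where
  "generated_submodule R M X = \<Inter>{N. submodule N R M \<and> X \<subseteq> N}"

definition quotient_module :: "('r, 'm, 'n) module_scheme \<Rightarrow> 'm set \<Rightarrow> ('r, 'm set) module" where
  "quotient_module M N =
     \<lparr>carrier = a_rcosets\<^bsub>M\<^esub> N, mult = undefined, one = undefined, ring.zero = N,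
      add = (<+>\<^bsub>M\<^esub>), smult = (\<lambda>r X. \<Union>x\<in>X. N +>\<^bsub>M\<^esub> (r \<odot>\<^bsub>M\<^esub> x))\<rparr>"

text \<open>The abelian group underlying the tensor product of two modules.\<close>

definition tensor_relations ::
    "('r, 'k) ring_scheme \<Rightarrow> ('r, 'a, 'm) module_scheme \<Rightarrow> ('r, 'b, 'n) module_scheme
      \<Rightarrow> ('a \<times> 'b \<Rightarrow>\<^sub>0 int) set" where
  "tensor_relations R M N =
     (let e = (\<lambda>x y. Poly_Mapping.single (x, y) (1::int)) in
      {e (x \<oplus>\<^bsub>M\<^esub> x') y - e x y - e x' y | x x' y.
         x \<in> carrier M \<and> x' \<in> carrier M \<and> y \<in> carrier N} \<union>
      {e x (y \<oplus>\<^bsub>N\<^esub> y') - e x y - e x y' | x y y'.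
         x \<in> carrier M \<and> y \<in> carrier N \<and> y' \<in> carrier N} \<union>
      {e (r \<odot>\<^bsub>M\<^esub> x) y - e x (r \<odot>\<^bsub>N\<^esub> y) | r x y.
         r \<in> carrier R \<and> x \<in> carrier M \<and> y \<in> carrier N})"

definition tensor_product ::
    "('r, 'k) ring_scheme \<Rightarrow> ('r, 'a, 'm) module_scheme \<Rightarrow> ('r, 'b, 'n) module_scheme
      \<Rightarrow> ('a \<times> 'b \<Rightarrow>\<^sub>0 int) set monoid" where
  "tensor_product R M N =
     free_Abelian_group (carrier M \<times> carrier N) Mod
       generate (free_Abelian_group (carrier M \<times> carrier N)) (tensor_relations R M N)"

definition int_module_via :: "('r \<Rightarrow> int) \<Rightarrow> ('r, int) module" where
  "int_module_via \<phi> =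
     \<lparr>carrier = UNIV, mult = (*), one = 1, ring.zero = 0, add = (+), smult = (\<lambda>r n. \<phi> r * n)\<rparr>"


lemma laurent_ring_simps:
  "x \<oplus>\<^bsub>laurent_ring l\<^esub> y = x + y" "x \<otimes>\<^bsub>laurent_ring l\<^esub> y = x * y"
  "\<zero>\<^bsub>laurent_ring l\<^esub> = 0" "\<one>\<^bsub>laurent_ring l\<^esub> = 1"
  by (simp_all add: laurent_ring_def)

lemma cring_laurent_ring: "cring (laurent_ring l)"
proof -
  let ?C = "carrier (laurent_ring l)"
  have C: "p \<in> ?C \<longleftrightarrow> (\<forall>e\<in>Poly_Mapping.keys p. Poly_Mapping.keys e \<subseteq> {1..l})" for p
    by (simp add: laurent_ring_def)
  have add: "p + q \<in> ?C" if "p \<in> ?C" "q \<in> ?C" for p q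
    using that subsetD[OF keys_add[of p q]] unfolding C by fast
  have mult: "p * q \<in> ?C" if "p \<in> ?C" "q \<in> ?C" for p q
    unfolding C
  proof
    fix e assume "e \<in> Poly_Mapping.keys (p * q)"
    then obtain a b where e: "e = a + b" "a \<in> Poly_Mapping.keys p" "b \<in> Poly_Mapping.keys q"
      using keys_mult[of p q] by blast
    then have "Poly_Mapping.keys a \<subseteq> {1..l}" "Poly_Mapping.keys b \<subseteq> {1..l}"
      using that by (simp_all add: C)
    then show "Poly_Mapping.keys e \<subseteq> {1..l}"
      using subset_trans[OF keys_add Un_least] e(1) by simp
  qed
  have zero: "0 \<in> ?C" and one: "1 \<in> ?C" and uminus: "p \<in> ?C \<Longrightarrow> - p \<in> ?C" for p
    by (simp_all add: C)
  show ?thesis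
  proof (intro cringI abelian_groupI comm_monoidI)
    fix x assume "x \<in> ?C"
    then show "\<exists>y\<in>?C. y \<oplus>\<^bsub>laurent_ring l\<^esub> x = \<zero>\<^bsub>laurent_ring l\<^esub>"
      by (intro bexI[of _ "- x"] uminus) (simp_all add: laurent_ring_simps)
  qed (simp_all add: laurent_ring_simps add mult zero one ac_simps distrib_left distrib_right)
qed

lemma laurent_var_in_carrier: "k \<in> {1..l} \<Longrightarrow> laurent_var k \<in> carrier (laurent_ring l)"
  by (simp add: laurent_ring_def laurent_var_def)

lemma lookup_smult_free_laurent_module:
  "Poly_Mapping.lookup (p \<odot>\<^bsub>free_laurent_module l S\<^esub> f) a = p * Poly_Mapping.lookup f a"
  by (simp add: free_laurent_module_def Poly_Mapping.map.rep_eq when_def)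

lemma module_free_laurent_module: "module (laurent_ring l) (free_laurent_module l S)"
proof -
  let ?R = "laurent_ring l" and ?M = "free_laurent_module l S"
  let ?lk = Poly_Mapping.lookup
  interpret R: cring ?R by (rule cring_laurent_ring)
  note R = laurent_ring_simps
  have M: "f \<oplus>\<^bsub>?M\<^esub> g = f + g" "\<zero>\<^bsub>?M\<^esub> = 0" for f g
    by (simp_all add: free_laurent_module_def)
  have C: "f \<in> carrier ?M \<longleftrightarrow> (\<forall>a. (a \<notin> S \<longrightarrow> ?lk f a = 0) \<and> ?lk f a \<in> carrier ?R)" for f
    by (auto simp: free_laurent_module_def in_keys_iff subset_iff)
  have add: "p + q \<in> carrier ?R" "p * q \<in> carrier ?R" if "p \<in> carrier ?R" "q \<in> carrier ?R" for p q
    using R.add.m_closed[OF that] R.m_closed[OF that] by (simp_all add: R)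
  have zero: "0 \<in> carrier ?R" and uminus: "p \<in> carrier ?R \<Longrightarrow> - p \<in> carrier ?R" for p
    by (simp_all add: laurent_ring_def)
  have ag: "abelian_group ?M"
  proof (rule abelian_groupI)
    fix x assume "x \<in> carrier ?M"
    then show "\<exists>y\<in>carrier ?M. y \<oplus>\<^bsub>?M\<^esub> x = \<zero>\<^bsub>?M\<^esub>"
      by (intro bexI[of _ "- x"]) (simp_all add: M C uminus)
  qed (simp_all add: C M lookup_add add zero ac_simps)
  note sm = lookup_smult_free_laurent_module
  show ?thesis
  proof (rule moduleI[OF R.is_cring ag])
    fix p q :: laurent and f g :: "'a \<Rightarrow>\<^sub>0 laurent"
    show "p \<odot>\<^bsub>?M\<^esub> f \<in> carrier ?M" if "p \<in> carrier ?R" "f \<in> carrier ?M"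
      using that by (simp add: C sm add)
    show "(p \<oplus>\<^bsub>?R\<^esub> q) \<odot>\<^bsub>?M\<^esub> f = p \<odot>\<^bsub>?M\<^esub> f \<oplus>\<^bsub>?M\<^esub> q \<odot>\<^bsub>?M\<^esub> f"
      by (rule poly_mapping_eqI) (simp add: sm R M lookup_add distrib_right)
    show "p \<odot>\<^bsub>?M\<^esub> (f \<oplus>\<^bsub>?M\<^esub> g) = p \<odot>\<^bsub>?M\<^esub> f \<oplus>\<^bsub>?M\<^esub> p \<odot>\<^bsub>?M\<^esub> g"
      by (rule poly_mapping_eqI) (simp add: sm R M lookup_add distrib_left)
    show "(p \<otimes>\<^bsub>?R\<^esub> q) \<odot>\<^bsub>?M\<^esub> f = p \<odot>\<^bsub>?M\<^esub> (q \<odot>\<^bsub>?M\<^esub> f)"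
      by (rule poly_mapping_eqI) (simp add: sm R mult.assoc)
    show "\<one>\<^bsub>?R\<^esub> \<odot>\<^bsub>?M\<^esub> f = f"
      by (rule poly_mapping_eqI) (simp add: sm R)
  qed
qed

lemma submodule_generated_submodule:
  assumes "module R M" and "X \<subseteq> carrier M"
  shows "submodule (generated_submodule R M X) R M"
proof -
  interpret module R M by fact
  have mem: "carrier M \<in> {N. submodule N R M \<and> X \<subseteq> N}"
    using carrier_is_submodule assms(2) by auto
  show ?thesis
    unfolding generated_submodule_def
  proof (rule submoduleI)
    show "\<Inter> {N. submodule N R M \<and> X \<subseteq> N} \<subseteq> carrier M" using mem by blast
    show "\<zero>\<^bsub>M\<^esub> \<in> \<Inter> {N. submodule N R M \<and> X \<subseteq> N}"
    proof (rule InterI)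
      fix N assume "N \<in> {N. submodule N R M \<and> X \<subseteq> N}"
      then have "subgroup N (add_monoid M)" using submodule.axioms(1) by blast
      then show "\<zero>\<^bsub>M\<^esub> \<in> N" using subgroup.one_closed by fastforce
    qed
  next
    fix a b assume a: "a \<in> \<Inter> {N. submodule N R M \<and> X \<subseteq> N}"
    then show "\<ominus>\<^bsub>M\<^esub> a \<in> \<Inter> {N. submodule N R M \<and> X \<subseteq> N}"
      using submoduleE(3) by simp
    show "a \<oplus>\<^bsub>M\<^esub> b \<in> \<Inter> {N. submodule N R M \<and> X \<subseteq> N}"
      if "b \<in> \<Inter> {N. submodule N R M \<and> X \<subseteq> N}"
      using a that submoduleE(5) by simp
  next
    fix r x assume "r \<in> carrier R" "x \<in> \<Inter> {N. submodule N R M \<and> X \<subseteq> N}"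
    then show "r \<odot>\<^bsub>M\<^esub> x \<in> \<Inter> {N. submodule N R M \<and> X \<subseteq> N}"
      using submoduleE(4) by simp
  qed
qed

lemma module_quotient_module:
  assumes "module R M" and N: "submodule N R M"
  shows "module R (quotient_module M N)"
proof -
  interpret module R M by fact
  have sg: "subgroup N (add_monoid M)" using N by (rule submodule.axioms(1))
  then interpret S: abelian_subgroup N M
    by (intro abelian_subgroupI3 additive_subgroup.intro M.abelian_group_axioms)
  let ?Q = "quotient_module M N"
  interpret F: comm_group "M A_Mod N" by (rule S.a_factorgroup_is_comm_group)
  have Q: "carrier (M A_Mod N) = carrier ?Q" "\<one>\<^bsub>M A_Mod N\<^esub> = \<zero>\<^bsub>?Q\<^esub>"
    "x \<otimes>\<^bsub>M A_Mod N\<^esub> y = x \<oplus>\<^bsub>?Q\<^esub> y" for x y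
    by (simp_all add: quotient_module_def A_FactGroup_def FactGroup_def A_RCOSETS_def set_add_def)
  have ag: "abelian_group ?Q"
  proof (rule abelian_groupI)
    show "\<exists>y\<in>carrier ?Q. y \<oplus>\<^bsub>?Q\<^esub> x = \<zero>\<^bsub>?Q\<^esub>" if "x \<in> carrier ?Q" for x
      using F.l_inv_ex[of x] that unfolding Q by blast
  qed (use F.m_closed F.one_closed F.m_assoc F.m_comm F.l_one in \<open>simp_all only: Q\<close>)
  have car: "\<exists>x\<in>carrier M. X = N +>\<^bsub>M\<^esub> x" if "X \<in> carrier ?Q" for X
    using that by (auto simp: quotient_module_def A_RCOSETS_def RCOSETS_def a_r_coset_def)
  have car': "N +>\<^bsub>M\<^esub> x \<in> carrier ?Q" if "x \<in> carrier M" for x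
    using that by (auto simp: quotient_module_def S.a_subset intro: M.a_rcosetsI)
  have add: "(N +>\<^bsub>M\<^esub> x) \<oplus>\<^bsub>?Q\<^esub> (N +>\<^bsub>M\<^esub> y) = N +>\<^bsub>M\<^esub> (x \<oplus>\<^bsub>M\<^esub> y)"
    if "x \<in> carrier M" "y \<in> carrier M" for x y
    using that by (simp add: quotient_module_def S.a_rcos_sum)
  have smult: "r \<odot>\<^bsub>?Q\<^esub> (N +>\<^bsub>M\<^esub> x) = N +>\<^bsub>M\<^esub> (r \<odot>\<^bsub>M\<^esub> x)"
    if r: "r \<in> carrier R" and x: "x \<in> carrier M" for r x
  proof -
    have eq: "N +>\<^bsub>M\<^esub> (r \<odot>\<^bsub>M\<^esub> y) = N +>\<^bsub>M\<^esub> (r \<odot>\<^bsub>M\<^esub> x)" if "y \<in> N +>\<^bsub>M\<^esub> x" for y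
    proof -
      obtain n where n: "n \<in> N" "y = n \<oplus>\<^bsub>M\<^esub> x"
        using \<open>y \<in> N +>\<^bsub>M\<^esub> x\<close> unfolding a_r_coset_def r_coset_def by auto
      then have "r \<odot>\<^bsub>M\<^esub> y = r \<odot>\<^bsub>M\<^esub> n \<oplus>\<^bsub>M\<^esub> r \<odot>\<^bsub>M\<^esub> x"
        using r x S.a_subset by (auto simp: smult_r_distr)
      moreover have "r \<odot>\<^bsub>M\<^esub> n \<in> N" using submodule.smult_closed[OF N r n(1)] .
      ultimately have "r \<odot>\<^bsub>M\<^esub> y \<in> N +>\<^bsub>M\<^esub> (r \<odot>\<^bsub>M\<^esub> x)"
        using r x S.a_subset M.a_rcosI by simp
      then show ?thesis using M.a_repr_independence[OF _ _ sg] r x by simp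
    qed
    have "x \<in> N +>\<^bsub>M\<^esub> x"
      using x S.a_rcos_self by auto
    then have "(\<Union>y\<in>N +>\<^bsub>M\<^esub> x. N +>\<^bsub>M\<^esub> (r \<odot>\<^bsub>M\<^esub> y)) = N +>\<^bsub>M\<^esub> (r \<odot>\<^bsub>M\<^esub> x)"
      by (intro SUP_eq_const eq) blast+
    then show ?thesis by (simp add: quotient_module_def)
  qed
  show ?thesis
  proof (rule moduleI[OF R.is_cring ag])
    fix r r' X Y assume r: "r \<in> carrier R" "r' \<in> carrier R"
      and X: "X \<in> carrier ?Q" and Y: "Y \<in> carrier ?Q"
    obtain x y where x: "x \<in> carrier M" "X = N +>\<^bsub>M\<^esub> x" and y: "y \<in> carrier M" "Y = N +>\<^bsub>M\<^esub> y"
      using car[OF X] car[OF Y] by blast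
    show "r \<odot>\<^bsub>?Q\<^esub> X \<in> carrier ?Q" using r x by (simp add: smult car')
    show "(r \<oplus>\<^bsub>R\<^esub> r') \<odot>\<^bsub>?Q\<^esub> X = r \<odot>\<^bsub>?Q\<^esub> X \<oplus>\<^bsub>?Q\<^esub> r' \<odot>\<^bsub>?Q\<^esub> X"
      using r x by (simp add: smult add smult_l_distr)
    show "r \<odot>\<^bsub>?Q\<^esub> (X \<oplus>\<^bsub>?Q\<^esub> Y) = r \<odot>\<^bsub>?Q\<^esub> X \<oplus>\<^bsub>?Q\<^esub> r \<odot>\<^bsub>?Q\<^esub> Y"
      using r x y by (simp add: smult add smult_r_distr)
    show "(r \<otimes>\<^bsub>R\<^esub> r') \<odot>\<^bsub>?Q\<^esub> X = r \<odot>\<^bsub>?Q\<^esub> (r' \<odot>\<^bsub>?Q\<^esub> X)"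
      using r x by (simp add: smult smult_assoc1)
  next
    fix X assume "X \<in> carrier ?Q"
    then show "\<one>\<^bsub>R\<^esub> \<odot>\<^bsub>?Q\<^esub> X = X" using car[of X] by (auto simp: smult)
  qed
qed

lemma module_int_module_via:
  assumes "cring R" "\<phi> \<in> ring_hom R int_ring"
  shows "module R (int_module_via \<phi>)"
proof (rule moduleI[OF assms(1)])
  show "abelian_group (int_module_via \<phi>)"
  proof (rule abelian_groupI)
    show "\<exists>y\<in>carrier (int_module_via \<phi>). y \<oplus>\<^bsub>int_module_via \<phi>\<^esub> x = \<zero>\<^bsub>int_module_via \<phi>\<^esub>" for x
      by (intro bexI[of _ "- x"]) (simp_all add: int_module_via_def)
  qed (simp_all add: int_module_via_def)
qed (use assms(2) in \<open>simp_all add: int_module_via_def ring_hom_def distrib_left distrib_right\<close>)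

lemma comm_group_tensor_product: 
  assumes "module R M" "module R N"
  shows "comm_group (tensor_product R M N)"
proof -
  interpret M: module R M by fact
  interpret N: module R N by fact
  let ?F = "free_Abelian_group (carrier M \<times> carrier N)"
  interpret F: comm_group ?F by (rule abelian_free_Abelian_group)
  have "tensor_relations R M N \<subseteq> carrier ?F"
    using keys_diff by (fastforce simp: tensor_relations_def Let_def dest!: subsetD[OF keys_diff])
  then show ?thesis
    unfolding tensor_product_def by (intro F.abelian_FactGroup F.generate_is_subgroup)
qed

text \<open>
  The ring homomorphism sending each variable \<open>t\<^sub>k\<close> to \<open>(-1) ^ \<tau> k\<close> exists, and it makes the integers a module.
\<close>

definition signature_hom :: "nat \<Rightarrow> (nat \<Rightarrow> nat) \<Rightarrow> laurent \<Rightarrow> int" where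
  "signature_hom l \<tau> p = (\<Sum>e\<in>Poly_Mapping.keys p. Poly_Mapping.lookup p e *
     (\<Prod>k\<in>{1..l}. ((-1) ^ \<tau> k) ^ nat \<bar>Poly_Mapping.lookup e k\<bar>))"

lemma signature_hom_exists:
  "signature_hom l \<tau> \<in> ring_hom (laurent_ring l) int_ring"
  "k \<in> {1..l} \<Longrightarrow> signature_hom l \<tau> (laurent_var k) = (-1) ^ \<tau> k"
proof -
  define w :: "(nat \<Rightarrow>\<^sub>0 int) \<Rightarrow> int" where
    "w e = (\<Prod>k\<in>{1..l}. ((-1) ^ \<tau> k) ^ nat \<bar>Poly_Mapping.lookup e k\<bar>)" for e
  have pw: "(((-1) ^ m) ^ nat \<bar>a + b\<bar> :: int) = ((-1) ^ m) ^ nat \<bar>a\<bar> * ((-1) ^ m) ^ nat \<bar>b\<bar>" for m a b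
    by (cases "even m") (auto simp: minus_one_power_iff even_nat_iff)
  have w_add: "w (e + f) = w e * w f" for e f
    unfolding w_def by (simp only: lookup_add pw prod.distrib)
  have h: "signature_hom l \<tau> p = (\<Sum>e\<in>Poly_Mapping.keys p. Poly_Mapping.lookup p e * w e)" for p
    by (simp add: signature_hom_def w_def)
  have add: "signature_hom l \<tau> (p + q) = signature_hom l \<tau> p + signature_hom l \<tau> q" for p q
    unfolding h by (rule setsum_keys_plus_distrib) (auto simp: algebra_simps)
  have diff: "signature_hom l \<tau> (p - q) = signature_hom l \<tau> p - signature_hom l \<tau> q" for p q
    using add[of "p - q" q] by simp
  have zero: "signature_hom l \<tau> 0 = 0" by (simp add: h)
  have single: "signature_hom l \<tau> (Poly_Mapping.single e 1) = w e" for e by (simp add: h)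
  have mult1: "signature_hom l \<tau> (Poly_Mapping.single e 1 * q)
      = w e * signature_hom l \<tau> q" for e q
    by (rule frag_induction[of q UNIV])
      (auto simp: zero single mult_single w_add right_diff_distrib diff)
  have mult: "signature_hom l \<tau> (p * q) = signature_hom l \<tau> p * signature_hom l \<tau> q" for p q
    by (rule frag_induction[of p UNIV]) (auto simp: zero single mult1 left_diff_distrib diff)
  have one: "signature_hom l \<tau> 1 = 1"
    using single[of 0] by (simp add: w_def)
  show "signature_hom l \<tau> \<in> ring_hom (laurent_ring l) int_ring"
    by (auto simp: ring_hom_def laurent_ring_def add mult one)
  show "signature_hom l \<tau> (laurent_var k) = (-1) ^ \<tau> k" if "k \<in> {1..l}"
  proof -
    have "w (Poly_Mapping.single k 1) = (\<Prod>j\<in>{1..l}. if j = k then (-1) ^ \<tau> k else 1)"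
      unfolding w_def by (rule prod.cong) (auto simp: lookup_single when_def)
    then show ?thesis using that by (simp add: laurent_var_def single)
  qed
qed


section \<open>The multivariable Alexander module\<close>

definition alexander_relation :: "nat \<Rightarrow> curves \<Rightarrow> crossing \<Rightarrow> (arc \<Rightarrow>\<^sub>0 laurent)" where
  "alexander_relation l D x =
     (let a = over_arc l D x; b = source_arc l D x; c = target_arc l D x;
          i = arc_component b; j = arc_component a
      in Poly_Mapping.single a (1 - laurent_var i) + Poly_Mapping.single b (laurent_var j)
           - Poly_Mapping.single c 1)"

definition alexander_module :: "nat \<Rightarrow> curves \<Rightarrow> (laurent, (arc \<Rightarrow>\<^sub>0 laurent) set) module" where
  "alexander_module l D =
     quotient_module (free_laurent_module l (arcs l D))
       (generated_submodule (laurent_ring l) (free_laurent_module l (arcs l D))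
          (alexander_relation l D ` crossings l D))"

end

theory Submission
  imports Defs
begin

text \<open>
  Tensoring is right exact: if a module over the Laurent polynomial ring \<open>\<Lambda>\<close> is presented by
  generators \<open>e\<^sub>a\<close> and relations, then its base change along \<open>\<phi> : \<Lambda> \<rightarrow> \<int>\<close> is the abelian group
  with the same generators, its relations being the old ones with \<open>\<phi>\<close> applied to every coefficient
  (\<open>base_change_presentation\<close>). For \<open>\<phi> t\<^sub>k = (-1)^\<tau>\<^sub>k\<close> the Alexander relation
  \<open>(1 - t\<^sub>i) e\<^sub>a + t\<^sub>j e\<^sub>b - e\<^sub>c\<close> becomes \<open>(1 - (-1)^\<tau>\<^sub>i) x\<^sub>a + (-1)^\<tau>\<^sub>j x\<^sub>b - x\<^sub>c\<close>, and
  \<open>1 - (-1)^\<epsilon> = 2 \<epsilon>\<close> for \<open>\<epsilon> \<in> {0, 1}\<close>, so that this is the row of the signature matrix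
  (\<open>map_laurent_hom_alexander_relation\<close>).

  The tensor product is itself an abelian group given by generators and relations, so right
  exactness is proved by comparing two presentations: \<open>iso_of_presentations\<close> gives an isomorphism as
  soon as each set of generators is expressed through the other, respecting the relations and
  mutually inversely up to them. The maps are \<open>a \<mapsto> 1 \<otimes> [e\<^sub>a]\<close> and \<open>n \<otimes> [f] \<mapsto> n \<phi>(f)\<close>, with \<open>\<phi>\<close>
  applied to the coefficients of \<open>f\<close>.

  Geometry has to show that the over-arc, source and target of a crossing really are arcs of the
  diagram (\<open>crossing_arcs\<close>), so that the relations lie in the free modules and involve only the
  variables of components of the link. For the under-arcs this holds because undercrossings are
  isolated on each component, and for the over-arc because at most two strands meet at a point of
  the plane, so that an over-strand never is an under-strand as well.
\<close>


section \<open>Presentations of abelian groups\<close>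

lemma generate_free_Abelian_group_closed:
  assumes "R \<subseteq> carrier (free_Abelian_group S)"
  defines "K \<equiv> generate (free_Abelian_group S) R"
  shows "0 \<in> K" "r \<in> R \<Longrightarrow> r \<in> K" "x \<in> K \<Longrightarrow> y \<in> K \<Longrightarrow> x + y \<in> K"
    "x \<in> K \<Longrightarrow> - x \<in> K" "x \<in> K \<Longrightarrow> y \<in> K \<Longrightarrow> x - y \<in> K" "x \<in> K \<Longrightarrow> frag_cmul n x \<in> K"
    "x \<in> K \<Longrightarrow> Poly_Mapping.keys x \<subseteq> S"
proof -
  interpret F: comm_group "free_Abelian_group S" by (rule abelian_free_Abelian_group)
  interpret K: subgroup K "free_Abelian_group S"
    unfolding K_def by (rule F.generate_is_subgroup) (rule assms(1))
  show zero: "0 \<in> K" using K.one_closed by simp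
  show "r \<in> R \<Longrightarrow> r \<in> K" unfolding K_def by (rule generate.incl)
  show add: "x \<in> K \<Longrightarrow> y \<in> K \<Longrightarrow> x + y \<in> K" for x y using K.m_closed[of x y] by simp
  show keys: "x \<in> K \<Longrightarrow> Poly_Mapping.keys x \<subseteq> S" for x using K.mem_carrier[of x] by simp
  show uminus: "x \<in> K \<Longrightarrow> - x \<in> K" for x
    using K.m_inv_closed[of x] keys[of x] by simp
  show diff: "x \<in> K \<Longrightarrow> y \<in> K \<Longrightarrow> x - y \<in> K" for x y using add[of x "- y"] uminus by simp
  show "x \<in> K \<Longrightarrow> frag_cmul n x \<in> K"
    using frag_closure_minus_cmul[of "\<lambda>x. x \<in> K"] zero diff by simp
qed

lemma frag_extend_in_subgroup:
  assumes R: "R \<subseteq> carrier (free_Abelian_group S)" and R': "R' \<subseteq> carrier (free_Abelian_group T)"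
    and "\<And>r. r \<in> R \<Longrightarrow> frag_extend u r \<in> generate (free_Abelian_group T) R'"
    and x: "x \<in> generate (free_Abelian_group S) R"
  shows "frag_extend u x \<in> generate (free_Abelian_group T) R'"
  using x
proof (induction x)
  case (inv h)
  then show ?case
    using assms generate_free_Abelian_group_closed(4)[OF R'] by (auto simp: frag_extend_minus)
qed (use assms generate_free_Abelian_group_closed[OF R'] in \<open>auto simp: frag_extend_add\<close>)

lemma frag_extend_inverse_mod:
  assumes R: "R \<subseteq> carrier (free_Abelian_group S)"
    and "\<And>a. a \<in> S \<Longrightarrow> frag_extend v (u a) - frag_of a \<in> generate (free_Abelian_group S) R"
    and "Poly_Mapping.keys x \<subseteq> S"
  shows "frag_extend v (frag_extend u x) - x \<in> generate (free_Abelian_group S) R"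
  using assms(3)
proof (induction x rule: frag_induction)
  case (diff a b)
  then show ?case
    using generate_free_Abelian_group_closed(5)[OF R, of "frag_extend v (frag_extend u a) - a"
        "frag_extend v (frag_extend u b) - b"]
    by (simp add: frag_extend_diff algebra_simps)
qed (use assms(2) generate_free_Abelian_group_closed[OF R] in auto)

text \<open>
  The substitutions given by \<open>u\<close> and \<open>v\<close> respect the relations by \<open>uR\<close> and \<open>vR'\<close>, and they are
  mutually inverse modulo the relations by \<open>vu\<close> and \<open>uv\<close>, as the generators show. Composing the
  first one with the projection to the second quotient gives the homomorphism \<open>h\<close> below: \<open>uv\<close> makes
  it surjective, its kernel contains only consequences of \<open>R\<close> by \<open>vR'\<close> and \<open>vu\<close>, and the first
  isomorphism theorem applies.
\<close>

lemma iso_of_presentations: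
  assumes R: "R \<subseteq> carrier (free_Abelian_group S)" and R': "R' \<subseteq> carrier (free_Abelian_group T)"
    and u: "\<And>a. a \<in> S \<Longrightarrow> Poly_Mapping.keys (u a) \<subseteq> T"
    and v: "\<And>b. b \<in> T \<Longrightarrow> Poly_Mapping.keys (v b) \<subseteq> S"
    and uR: "\<And>r. r \<in> R \<Longrightarrow> frag_extend u r \<in> generate (free_Abelian_group T) R'"
    and vR': "\<And>r. r \<in> R' \<Longrightarrow> frag_extend v r \<in> generate (free_Abelian_group S) R"
    and vu: "\<And>a. a \<in> S \<Longrightarrow> frag_extend v (u a) - frag_of a \<in> generate (free_Abelian_group S) R"
    and uv: "\<And>b. b \<in> T \<Longrightarrow> frag_extend u (v b) - frag_of b \<in> generate (free_Abelian_group T) R'"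
  shows "free_Abelian_group S Mod generate (free_Abelian_group S) R \<cong>
    free_Abelian_group T Mod generate (free_Abelian_group T) R'"
proof -
  let ?F = "free_Abelian_group S" and ?G = "free_Abelian_group T"
  let ?K = "generate ?F R" and ?L = "generate ?G R'"
  interpret F: comm_group ?F by (rule abelian_free_Abelian_group)
  interpret G: comm_group ?G by (rule abelian_free_Abelian_group)
  have subL: "subgroup ?L ?G" using R' by (rule G.generate_is_subgroup)
  then interpret L: normal ?L ?G by (rule G.subgroup_imp_normal)
  interpret Q: group "?G Mod ?L" by (rule L.factorgroup_is_group)
  have ku: "Poly_Mapping.keys (frag_extend u x) \<subseteq> T" if "Poly_Mapping.keys x \<subseteq> S" for x
    using keys_frag_extend[of u x] u that by blast
  have kv: "Poly_Mapping.keys (frag_extend v y) \<subseteq> S" if "Poly_Mapping.keys y \<subseteq> T" for y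
    using keys_frag_extend[of v y] v that by blast
  define h where "h x = ?L #>\<^bsub>?G\<^esub> frag_extend u x" for x
  have hom: "h \<in> hom ?F (?G Mod ?L)"
  proof (rule homI)
    fix x y assume "x \<in> carrier ?F" "y \<in> carrier ?F"
    then show "h (x \<otimes>\<^bsub>?F\<^esub> y) = h x \<otimes>\<^bsub>?G Mod ?L\<^esub> h y"
      using L.rcos_sum[of "frag_extend u x" "frag_extend u y"] ku
      by (simp add: h_def frag_extend_add)
  qed (use ku G.rcosetsI[OF L.subset] in \<open>auto simp: h_def FactGroup_def\<close>)
  interpret h: group_hom ?F "?G Mod ?L" h
    by unfold_locales (rule hom)
  have coset_eq: "?L #>\<^bsub>?G\<^esub> x = ?L #>\<^bsub>?G\<^esub> y" if "x - y \<in> ?L" "Poly_Mapping.keys y \<subseteq> T" for x y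
  proof -
    have "x \<in> ?L #>\<^bsub>?G\<^esub> y" using that by (auto simp: r_coset_def intro!: bexI[of _ "x - y"])
    then show ?thesis using G.repr_independence[OF _ _ subL] that(2) by simp
  qed
  have ker: "kernel ?F (?G Mod ?L) h = ?K"
  proof safe
    fix x assume "x \<in> kernel ?F (?G Mod ?L) h"
    then have x: "Poly_Mapping.keys x \<subseteq> S" and "?L #>\<^bsub>?G\<^esub> frag_extend u x = ?L"
      by (auto simp: kernel_def h_def FactGroup_def)
    then have "frag_extend u x \<in> ?L"
      using G.rcos_self[OF _ subL, of "frag_extend u x"] ku by simp
    from frag_extend_in_subgroup[OF R' R vR' this]
    have "frag_extend v (frag_extend u x) \<in> ?K" .
    from generate_free_Abelian_group_closed(5)[OF R this frag_extend_inverse_mod[OF R vu x]]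
    show "x \<in> ?K" by simp
  next
    fix x assume x: "x \<in> ?K"
    have "frag_extend u x \<in> ?L" by (rule frag_extend_in_subgroup[OF R R' uR x])
    then show "x \<in> kernel ?F (?G Mod ?L) h"
      using L.rcos_const[OF G.is_group] generate_free_Abelian_group_closed(7)[OF R x]
      by (simp add: kernel_def h_def FactGroup_def)
  qed
  have surj: "h ` carrier ?F = carrier (?G Mod ?L)"
  proof
    show "h ` carrier ?F \<subseteq> carrier (?G Mod ?L)" using hom by (auto simp: hom_def)
    show "carrier (?G Mod ?L) \<subseteq> h ` carrier ?F"
    proof
      fix Y assume "Y \<in> carrier (?G Mod ?L)"
      then obtain y where y: "Poly_Mapping.keys y \<subseteq> T" "Y = ?L #>\<^bsub>?G\<^esub> y"
        by (auto simp: FactGroup_def RCOSETS_def)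
      have "h (frag_extend v y) = Y"
        unfolding h_def y(2) by (rule coset_eq[OF frag_extend_inverse_mod[OF R' uv y(1)] y(1)])
      then show "Y \<in> h ` carrier ?F" using kv[OF y(1)] by force
    qed
  qed
  show ?thesis using h.FactGroup_iso[OF surj] unfolding ker .
qed


section \<open>Base change of a presented module over a Laurent polynomial ring\<close>

lemma zero_in_free_laurent_module: "0 \<in> carrier (free_laurent_module l S)"
  by (simp add: free_laurent_module_def laurent_ring_def)

lemma add_in_free_laurent_module:
  assumes "f \<in> carrier (free_laurent_module l S)" and "g \<in> carrier (free_laurent_module l S)"
  shows "f + g \<in> carrier (free_laurent_module l S)"
proof -
  interpret module "laurent_ring l" "free_laurent_module l S" by (rule module_free_laurent_module)
  show ?thesis using M.add.m_closed[OF assms] by (simp add: free_laurent_module_def)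
qed

lemma uminus_in_free_laurent_module:
  assumes "f \<in> carrier (free_laurent_module l S)"
  shows "- f \<in> carrier (free_laurent_module l S)"
  using assms by (simp add: free_laurent_module_def laurent_ring_def)

lemma diff_in_free_laurent_module:
  assumes "f \<in> carrier (free_laurent_module l S)" and "g \<in> carrier (free_laurent_module l S)"
  shows "f - g \<in> carrier (free_laurent_module l S)"
  using add_in_free_laurent_module[OF assms(1) uminus_in_free_laurent_module[OF assms(2)]] by simp

lemma single_in_free_laurent_module:
  assumes "a \<in> S" and "p \<in> carrier (laurent_ring l)"
  shows "Poly_Mapping.single a p \<in> carrier (free_laurent_module l S)"
  using assms by (auto simp: free_laurent_module_def laurent_ring_def lookup_single when_def)

context
  fixes l :: nat and \<phi> :: "laurent \<Rightarrow> int"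
  assumes \<phi>: "\<phi> \<in> ring_hom (laurent_ring l) int_ring"
begin

lemma laurent_hom:
  shows "p \<in> carrier (laurent_ring l) \<Longrightarrow> q \<in> carrier (laurent_ring l) \<Longrightarrow> \<phi> (p + q) = \<phi> p + \<phi> q"
    and "p \<in> carrier (laurent_ring l) \<Longrightarrow> q \<in> carrier (laurent_ring l) \<Longrightarrow> \<phi> (p * q) = \<phi> p * \<phi> q"
    and "\<phi> 1 = 1" and "\<phi> 0 = 0"
proof -
  show "p \<in> carrier (laurent_ring l) \<Longrightarrow> q \<in> carrier (laurent_ring l) \<Longrightarrow> \<phi> (p + q) = \<phi> p + \<phi> q" for p q
    using ring_hom_add[OF \<phi>, of p q] by (simp add: laurent_ring_simps)
  from this[of 0 0] show "\<phi> 0 = 0" by (simp add: laurent_ring_def)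
  show "p \<in> carrier (laurent_ring l) \<Longrightarrow> q \<in> carrier (laurent_ring l) \<Longrightarrow> \<phi> (p * q) = \<phi> p * \<phi> q"
    using ring_hom_mult[OF \<phi>, of p q] by (simp add: laurent_ring_simps)
  show "\<phi> 1 = 1" using ring_hom_one[OF \<phi>] by (simp add: laurent_ring_simps)
qed

lemma lookup_map_laurent_hom:
  "Poly_Mapping.lookup (Poly_Mapping.map \<phi> f) a = \<phi> (Poly_Mapping.lookup f a)"
  by (simp add: Poly_Mapping.map.rep_eq when_def laurent_hom(4))

lemma map_laurent_hom_zero: "Poly_Mapping.map \<phi> 0 = 0"
  by (rule poly_mapping_eqI) (simp add: lookup_map_laurent_hom laurent_hom)

lemma map_laurent_hom_single:
  "Poly_Mapping.map \<phi> (Poly_Mapping.single a p) = Poly_Mapping.single a (\<phi> p)"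
  by (rule poly_mapping_eqI) (simp add: lookup_map_laurent_hom lookup_single when_def laurent_hom)

lemma map_laurent_hom_add:
  assumes "f \<in> carrier (free_laurent_module l S)" and "g \<in> carrier (free_laurent_module l S)"
  shows "Poly_Mapping.map \<phi> (f + g) = Poly_Mapping.map \<phi> f + Poly_Mapping.map \<phi> g"
  by (rule poly_mapping_eqI)
    (use assms in \<open>simp add: free_laurent_module_def lookup_map_laurent_hom lookup_add laurent_hom\<close>)

lemma map_laurent_hom_diff:
  assumes "f \<in> carrier (free_laurent_module l S)" and "g \<in> carrier (free_laurent_module l S)"
  shows "Poly_Mapping.map \<phi> (f - g) = Poly_Mapping.map \<phi> f - Poly_Mapping.map \<phi> g"
  using map_laurent_hom_add[OF diff_in_free_laurent_module[OF assms] assms(2)] by simp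

lemma map_laurent_hom_smult:
  assumes "p \<in> carrier (laurent_ring l)" and "f \<in> carrier (free_laurent_module l S)"
  shows "Poly_Mapping.map \<phi> (p \<odot>\<^bsub>free_laurent_module l S\<^esub> f) = frag_cmul (\<phi> p) (Poly_Mapping.map \<phi> f)"
proof (rule poly_mapping_eqI)
  fix a
  have "Poly_Mapping.lookup f a \<in> carrier (laurent_ring l)"
    using assms(2) by (simp add: free_laurent_module_def)
  then show "Poly_Mapping.lookup (Poly_Mapping.map \<phi> (p \<odot>\<^bsub>free_laurent_module l S\<^esub> f)) a
      = Poly_Mapping.lookup (frag_cmul (\<phi> p) (Poly_Mapping.map \<phi> f)) a"
    using assms(1) by (simp add: lookup_map_laurent_hom lookup_smult_free_laurent_module laurent_hom)
qed

lemma keys_map_laurent_hom: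
  assumes "f \<in> carrier (free_laurent_module l S)"
  shows "Poly_Mapping.keys (Poly_Mapping.map \<phi> f) \<subseteq> S"
  using assms by (force simp: free_laurent_module_def in_keys_iff lookup_map_laurent_hom laurent_hom(4))

text \<open>
  Right exactness of the tensor product, in terms of presentations. The homomorphism from the tensor
  product sends \<open>n \<otimes> [f]\<close> to \<open>n \<Phi>(f)\<close>, where \<open>\<Phi>\<close> applies \<open>\<phi>\<close> to all coefficients. It does not
  depend on the representative \<open>f\<close>, since \<open>\<Phi>\<close> takes the submodule generated by \<open>X\<close> to the
  subgroup generated by \<open>\<Phi> X\<close>: multiplying a relation by a Laurent polynomial \<open>p\<close> only multiplies its
  image by the integer \<open>\<phi> p\<close>. In the other direction \<open>a \<mapsto> 1 \<otimes> [e\<^sub>a]\<close> extends to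
  \<open>\<Phi>(f) \<mapsto> 1 \<otimes> [f]\<close>, since \<open>\<phi>(p) \<otimes> [e\<^sub>a] = 1 \<otimes> [p e\<^sub>a]\<close>, and so it kills \<open>\<Phi> X\<close>.
\<close>

lemma base_change_presentation:
  fixes X :: "('a \<Rightarrow>\<^sub>0 laurent) set"
  assumes X: "X \<subseteq> carrier (free_laurent_module l S)"
  shows "free_Abelian_group S Mod generate (free_Abelian_group S) (Poly_Mapping.map \<phi> ` X) \<cong>
    tensor_product (laurent_ring l) (int_module_via \<phi>)
      (quotient_module (free_laurent_module l S)
        (generated_submodule (laurent_ring l) (free_laurent_module l S) X))"
proof -
  let ?R = "laurent_ring l" and ?M = "free_laurent_module l S" and ?A = "int_module_via \<phi>"
  let ?C = "carrier ?R"
  define N where "N = generated_submodule ?R ?M X"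
  define Q where "Q = quotient_module ?M N"
  define \<Phi> :: "('a \<Rightarrow>\<^sub>0 laurent) \<Rightarrow> ('a \<Rightarrow>\<^sub>0 int)" where "\<Phi> = Poly_Mapping.map \<phi>"
  let ?F = "free_Abelian_group S" and ?G = "free_Abelian_group (carrier ?A \<times> carrier Q)"
  let ?K = "generate ?F (\<Phi> ` X)" and ?T = "tensor_relations ?R ?A Q"
  let ?L = "generate ?G ?T"
  interpret M: module ?R ?M by (rule module_free_laurent_module)
  have Ms: "f \<oplus>\<^bsub>?M\<^esub> g = f + g" "\<zero>\<^bsub>?M\<^esub> = 0" for f g by (simp_all add: free_laurent_module_def)
  have CM: "f \<in> carrier ?M \<longleftrightarrow> Poly_Mapping.keys f \<subseteq> S \<and> (\<forall>a. Poly_Mapping.lookup f a \<in> ?C)" for f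
    by (simp add: free_laurent_module_def)
  have uminusM: "\<ominus>\<^bsub>?M\<^esub> f = - f" if "f \<in> carrier ?M" for f
    using that uminus_in_free_laurent_module[OF that]
    by (intro M.minus_equality) (simp_all add: Ms)
  have C: "1 \<in> ?C" by (simp add: laurent_ring_def)
  have zeroM: "0 \<in> carrier ?M" by (rule zero_in_free_laurent_module)
  note addM = add_in_free_laurent_module
    and diffM = diff_in_free_laurent_module and single_M = single_in_free_laurent_module
  have \<Phi>_zero: "\<Phi> 0 = 0"
    unfolding \<Phi>_def by (rule map_laurent_hom_zero)
  have \<Phi>_add: "\<Phi> (f + g) = \<Phi> f + \<Phi> g" if "f \<in> carrier ?M" "g \<in> carrier ?M" for f g
    unfolding \<Phi>_def using that by (rule map_laurent_hom_add)
  have \<Phi>_diff: "\<Phi> (f - g) = \<Phi> f - \<Phi> g" if "f \<in> carrier ?M" "g \<in> carrier ?M" for f g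
    unfolding \<Phi>_def using that by (rule map_laurent_hom_diff)
  have \<Phi>_smult: "\<Phi> (p \<odot>\<^bsub>?M\<^esub> f) = frag_cmul (\<phi> p) (\<Phi> f)" if "p \<in> ?C" "f \<in> carrier ?M" for p f
    unfolding \<Phi>_def using that by (rule map_laurent_hom_smult)
  have \<Phi>_keys: "Poly_Mapping.keys (\<Phi> f) \<subseteq> S" if "f \<in> carrier ?M" for f
    unfolding \<Phi>_def using that by (rule keys_map_laurent_hom)
  have \<Phi>_single: "\<Phi> (Poly_Mapping.single a 1) = frag_of a" for a
    unfolding \<Phi>_def map_laurent_hom_single laurent_hom(3) ..

  have \<Phi>X: "\<Phi> ` X \<subseteq> carrier ?F" using X \<Phi>_keys by auto
  note K = generate_free_Abelian_group_closed[OF \<Phi>X]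
  have N: "submodule N ?R ?M" unfolding N_def
    using M.module_axioms X by (rule submodule_generated_submodule)
  note NE = M.submoduleE[OF N]
  have N_zero: "0 \<in> N" using subgroup.one_closed[OF submodule.axioms(1)[OF N]] by (simp add: Ms)
  have N_add: "f + g \<in> N" if "f \<in> N" "g \<in> N" for f g using NE(5)[OF that] by (simp add: Ms)
  have N_uminus: "- f \<in> N" if "f \<in> N" for f using NE(3)[OF that] uminusM that NE(1) by auto
  have XN: "X \<subseteq> N" by (auto simp: N_def generated_submodule_def)
  \<comment> \<open>The elements that \<open>\<Phi>\<close> maps into \<open>?K\<close> form a submodule, because \<open>\<Phi>\<close> is \<open>\<phi>\<close>-semilinear.\<close>
  have \<Phi>N: "\<Phi> f \<in> ?K" if "f \<in> N" for f
  proof -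
    have "submodule {f \<in> carrier ?M. \<Phi> f \<in> ?K} ?R ?M"
    proof (rule M.submoduleI)
      show "\<ominus>\<^bsub>?M\<^esub> f \<in> {f \<in> carrier ?M. \<Phi> f \<in> ?K}" if "f \<in> {f \<in> carrier ?M. \<Phi> f \<in> ?K}" for f
        using that uminusM[of f] \<Phi>_diff[OF zeroM, of f] K(4)[of "\<Phi> f"]
          uminus_in_free_laurent_module[of f l S]
        by (simp add: Ms \<Phi>_zero)
    qed (auto simp: Ms \<Phi>_zero \<Phi>_add \<Phi>_smult addM K(1,3,6) zeroM)
    moreover have "X \<subseteq> {f \<in> carrier ?M. \<Phi> f \<in> ?K}" using X K(2) by auto
    ultimately show ?thesis using that unfolding N_def generated_submodule_def by blast
  qed

  have sgN: "subgroup N (add_monoid ?M)" using N by (rule submodule.axioms(1))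
  interpret N: abelian_subgroup N ?M
    using sgN by (intro abelian_subgroupI3 additive_subgroup.intro M.abelian_group_axioms)
  define cl where "cl f = N +>\<^bsub>?M\<^esub> f" for f
  have mem_cl: "g \<in> cl f \<longleftrightarrow> g - f \<in> N" for f g
    by (auto simp: cl_def a_r_coset_def r_coset_def free_laurent_module_def intro: bexI[of _ "g - f"])
  have cl_eq: "cl f = cl g" if "f - g \<in> N" for f g
  proof (rule Set.set_eqI)
    fix h show "h \<in> cl f \<longleftrightarrow> h \<in> cl g"
      using N_add[OF _ that, of "h - f"] N_add[OF _ N_uminus[OF that], of "h - g"]
      by (auto simp: mem_cl)
  qed
  have cl_Q: "cl f \<in> carrier Q" if "f \<in> carrier ?M" for f
    using M.a_rcosetsI[OF NE(1) that] by (simp add: Q_def quotient_module_def cl_def)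
  have Q_cl: "\<exists>f\<in>carrier ?M. q = cl f" if "q \<in> carrier Q" for q
    using that by (auto simp: Q_def quotient_module_def cl_def A_RCOSETS_def RCOSETS_def a_r_coset_def)
  have cl_add: "cl f \<oplus>\<^bsub>Q\<^esub> cl g = cl (f + g)" if "f \<in> carrier ?M" "g \<in> carrier ?M" for f g
    using N.a_rcos_sum[OF that] by (simp add: Q_def quotient_module_def cl_def Ms)
  have cl_smult: "p \<odot>\<^bsub>Q\<^esub> cl f = cl (p \<odot>\<^bsub>?M\<^esub> f)" if p: "p \<in> ?C" and f: "f \<in> carrier ?M" for p f
  proof -
    have "cl (p \<odot>\<^bsub>?M\<^esub> g) = cl (p \<odot>\<^bsub>?M\<^esub> f)" if "g \<in> cl f" for g
    proof (rule cl_eq)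
      have "p \<odot>\<^bsub>?M\<^esub> (g - f) \<in> N" using NE(4)[OF p] that by (simp add: mem_cl)
      moreover have "p \<odot>\<^bsub>?M\<^esub> (g - f) = p \<odot>\<^bsub>?M\<^esub> g - p \<odot>\<^bsub>?M\<^esub> f"
        by (rule poly_mapping_eqI)
          (simp add: lookup_smult_free_laurent_module lookup_minus right_diff_distrib)
      ultimately show "p \<odot>\<^bsub>?M\<^esub> g - p \<odot>\<^bsub>?M\<^esub> f \<in> N" by simp
    qed
    moreover have "f \<in> cl f" by (simp add: mem_cl N_zero)
    ultimately have "(\<Union>g\<in>cl f. cl (p \<odot>\<^bsub>?M\<^esub> g)) = cl (p \<odot>\<^bsub>?M\<^esub> f)" by blast
    then show ?thesis by (simp add: Q_def quotient_module_def cl_def)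
  qed
  \<comment> \<open>The map out of the tensor product is defined on chosen representatives of the cosets in \<open>Q\<close>;
    another choice would change it by elements of \<open>?K\<close> only.\<close>
  define rep where "rep q = (SOME f. f \<in> q)" for q :: "('a \<Rightarrow>\<^sub>0 laurent) set"
  have rep: "rep (cl f) - f \<in> N" for f
    using someI[of "\<lambda>g. g \<in> cl f" f] by (simp add: rep_def mem_cl N_zero)
  have rep_M: "rep q \<in> carrier ?M" and cl_rep: "cl (rep q) = q" if "q \<in> carrier Q" for q
  proof -
    obtain f where f: "f \<in> carrier ?M" "q = cl f" using Q_cl \<open>q \<in> carrier Q\<close> by blast
    show "rep q \<in> carrier ?M" using addM[OF subsetD[OF NE(1) rep] f(1), of f] f by simp
    show "cl (rep q) = q" using cl_eq[OF rep] f by simp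
  qed
  interpret Q: module ?R Q
    unfolding Q_def using M.module_axioms N by (rule module_quotient_module)

  have A: "carrier ?A = UNIV" "m \<oplus>\<^bsub>?A\<^esub> n = m + n" "p \<odot>\<^bsub>?A\<^esub> n = \<phi> p * n" for m n p
    by (simp_all add: int_module_via_def)
  let ?e = "\<lambda>n q. frag_of (n :: int, q :: ('a \<Rightarrow>\<^sub>0 laurent) set)"
  have T: "?T \<subseteq> carrier ?G"
  proof
    have d: "Poly_Mapping.keys (a - b) \<subseteq> U"
      if "Poly_Mapping.keys a \<subseteq> U" "Poly_Mapping.keys b \<subseteq> U" for a b :: "_ \<Rightarrow>\<^sub>0 int" and U
      using keys_diff[of a b] that by blast
    fix r assume "r \<in> ?T"
    then show "r \<in> carrier ?G"
      unfolding tensor_relations_def Let_def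
      by (safe; simp only: carrier_free_Abelian_group_iff; intro d; simp add: A)
  qed
  note L = generate_free_Abelian_group_closed[OF T]
  have L1: "?e (m + n) q - ?e m q - ?e n q \<in> ?L" if "q \<in> carrier Q" for m n q
    by (rule L(2)) (use that in \<open>force simp: tensor_relations_def Let_def A\<close>)
  have L2: "?e n (q \<oplus>\<^bsub>Q\<^esub> q') - ?e n q - ?e n q' \<in> ?L" if "q \<in> carrier Q" "q' \<in> carrier Q" for n q q'
    by (rule L(2)) (use that in \<open>force simp: tensor_relations_def Let_def A\<close>)
  have L3: "?e (\<phi> p * n) q - ?e n (p \<odot>\<^bsub>Q\<^esub> q) \<in> ?L" if "p \<in> ?C" "q \<in> carrier Q" for n p q
    by (rule L(2)) (use that in \<open>force simp: tensor_relations_def Let_def A\<close>)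
  have L_trans: "x - z \<in> ?L" if "x - y \<in> ?L" "y - z \<in> ?L" for x y z
    using L(3)[OF that] by simp
  \<comment> \<open>Additivity in the first factor alone already gives \<open>n (1 \<otimes> q) = n \<otimes> q\<close>.\<close>
  have e_cmul: "frag_cmul n (?e 1 q) - ?e n q \<in> ?L" if q: "q \<in> carrier Q" for n q
  proof -
    have e0: "?e 0 q \<in> ?L" using L(4)[OF L1[OF q, of 0 0]] by simp
    show ?thesis
    proof (induction n rule: int_induct[where k = 0])
      case base then show ?case using L(4)[OF e0] by simp
    next
      case (step1 i)
      show ?case using L(5)[OF step1(2) L1[OF q, of i 1]]
        by (simp add: frag_cmul_distrib algebra_simps)
    next
      case (step2 i)
      show ?case using L(3)[OF step2(2) L1[OF q, of "i - 1" 1]]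
        by (simp add: frag_cmul_diff_distrib algebra_simps)
    qed
  qed

  define u where "u a = ?e 1 (cl (Poly_Mapping.single a 1))" for a
  define v where "v = (\<lambda>(n, q). frag_cmul n (\<Phi> (rep q)))"
  \<comment> \<open>By additivity it suffices to consider \<open>f = p e\<^sub>a\<close>, where the two sides are
    \<open>\<phi>(p) (1 \<otimes> [e\<^sub>a]) = \<phi>(p) \<otimes> [e\<^sub>a]\<close> and \<open>1 \<otimes> p [e\<^sub>a]\<close>.\<close>
  have u\<Phi>: "frag_extend u (\<Phi> f) - ?e 1 (cl f) \<in> ?L" if "f \<in> carrier ?M" for f
    using that
  proof (induction f rule: update_induct)
    case const
    have "?e 1 (cl 0) \<in> ?L"
      using L(4)[OF L2[OF cl_Q[of 0] cl_Q[of 0], of 1]] zeroM cl_add[of 0 0] by (simp add: Ms)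
    then show ?case using L(4) by (simp add: \<Phi>_zero)
  next
    case (update f a p)
    have la: "Poly_Mapping.lookup f a = 0" using update(1) by (simp add: in_keys_iff)
    have eq: "Poly_Mapping.update a p f = f + Poly_Mapping.single a p"
      by (rule poly_mapping_eqI) (auto simp: lookup_update lookup_add lookup_single when_def la)
    have p: "p \<in> ?C" and a: "a \<in> S"
      using update(2,4) by (auto simp: CM keys_update lookup_update split: if_splits dest: spec[of _ a])
    note s = single_M[OF a p]
    have f: "f \<in> carrier ?M" using diffM[OF update(4) s] by (simp add: eq)
    let ?b = "Poly_Mapping.single a (1 :: laurent)"
    have b: "?b \<in> carrier ?M" using single_M[OF a C] .
    have ps: "Poly_Mapping.single a p = p \<odot>\<^bsub>?M\<^esub> ?b"
      by (rule poly_mapping_eqI) (simp add: lookup_smult_free_laurent_module lookup_single when_def)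
    have "frag_extend u (\<Phi> (Poly_Mapping.single a p)) = frag_cmul (\<phi> p) (?e 1 (cl ?b))"
      unfolding ps \<Phi>_smult[OF p b] \<Phi>_single by (simp add: frag_extend_cmul u_def)
    then have "frag_extend u (\<Phi> (Poly_Mapping.single a p)) - ?e 1 (cl (Poly_Mapping.single a p)) \<in> ?L"
      using L_trans[OF e_cmul[OF cl_Q[OF b], of "\<phi> p"]] L3[OF p cl_Q[OF b], of 1]
      by (simp add: ps cl_smult[OF p b])
    from L(5)[OF L(3)[OF update(3)[OF f] this] L2[OF cl_Q[OF f] cl_Q[OF s], of 1]]
    show ?case
      by (simp add: eq \<Phi>_add[OF f s] frag_extend_add cl_add[OF f s] algebra_simps)
  qed

  have "?F Mod ?K \<cong> ?G Mod ?L"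
  proof (rule iso_of_presentations[where u = u and v = v])
    show "\<Phi> ` X \<subseteq> carrier ?F" "?T \<subseteq> carrier ?G" by fact+
    show "Poly_Mapping.keys (u a) \<subseteq> carrier ?A \<times> carrier Q" if "a \<in> S" for a
      using that by (simp add: u_def A cl_Q single_M C)
    show "Poly_Mapping.keys (v b) \<subseteq> S" if "b \<in> carrier ?A \<times> carrier Q" for b
      using that \<Phi>_keys[OF rep_M] keys_cmul by (force simp: v_def)
    show "frag_extend u r \<in> ?L" if "r \<in> \<Phi> ` X" for r
    proof -
      obtain f where f: "f \<in> X" "r = \<Phi> f" using \<open>r \<in> \<Phi> ` X\<close> by blast
      have "cl f = cl 0" using f XN by (intro cl_eq) auto
      then have "?e 1 (cl f) \<in> ?L"
        using L(5)[OF _ u\<Phi>[of 0], of 0] L(1) zeroM by (simp add: Ms \<Phi>_zero)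
      have "f \<in> carrier ?M" using f X by auto
      from L(3)[OF u\<Phi>[OF this] \<open>?e 1 (cl f) \<in> ?L\<close>] show ?thesis by (simp add: f)
    qed
    show "frag_extend v r \<in> ?K" if "r \<in> ?T" for r
    proof -
      consider (1) m n q where "q \<in> carrier Q" "r = ?e (m + n) q - ?e m q - ?e n q"
        | (2) n q q' where "q \<in> carrier Q" "q' \<in> carrier Q" "r = ?e n (q \<oplus>\<^bsub>Q\<^esub> q') - ?e n q - ?e n q'"
        | (3) p n q where "p \<in> ?C" "q \<in> carrier Q" "r = ?e (\<phi> p * n) q - ?e n (p \<odot>\<^bsub>Q\<^esub> q)"
        using \<open>r \<in> ?T\<close> unfolding tensor_relations_def Let_def A by blast
      then show ?thesis
      proof cases
        case 1
        then show ?thesis using K(1) by (simp add: frag_extend_diff v_def frag_cmul_distrib)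
      next
        case 2
        note r = rep_M[OF 2(1)] rep_M[OF 2(2)]
        have "rep (q \<oplus>\<^bsub>Q\<^esub> q') - (rep q + rep q') \<in> N"
          using rep[of "rep q + rep q'"] cl_add[OF r] by (simp add: cl_rep 2)
        from \<Phi>N[OF this] have "\<Phi> (rep (q \<oplus>\<^bsub>Q\<^esub> q')) - \<Phi> (rep q) - \<Phi> (rep q') \<in> ?K"
          using 2 by (simp add: \<Phi>_diff \<Phi>_add addM rep_M algebra_simps)
        moreover have "frag_extend v r = frag_cmul n (\<Phi> (rep (q \<oplus>\<^bsub>Q\<^esub> q')) - \<Phi> (rep q) - \<Phi> (rep q'))"
          unfolding 2 by (rule poly_mapping_eqI)
            (simp add: frag_extend_diff v_def lookup_minus right_diff_distrib)
        ultimately show ?thesis using K(6) by simp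
      next
        case 3
        note r = rep_M[OF 3(2)]
        have "rep (p \<odot>\<^bsub>Q\<^esub> q) - p \<odot>\<^bsub>?M\<^esub> rep q \<in> N"
          using rep[of "p \<odot>\<^bsub>?M\<^esub> rep q"] cl_smult[OF 3(1) r] by (simp add: cl_rep 3)
        from \<Phi>N[OF this] have "\<Phi> (rep (p \<odot>\<^bsub>Q\<^esub> q)) - frag_cmul (\<phi> p) (\<Phi> (rep q)) \<in> ?K"
          using 3 by (simp add: \<Phi>_diff \<Phi>_smult rep_M)
        moreover have "frag_extend v r
            = frag_cmul (- n) (\<Phi> (rep (p \<odot>\<^bsub>Q\<^esub> q)) - frag_cmul (\<phi> p) (\<Phi> (rep q)))"
          unfolding 3 by (rule poly_mapping_eqI)
            (simp add: frag_extend_diff v_def lookup_minus right_diff_distrib)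
        ultimately show ?thesis using K(6) by simp
      qed
    qed
    show "frag_extend v (u a) - frag_of a \<in> ?K" if "a \<in> S" for a
    proof -
      let ?b = "Poly_Mapping.single a (1 :: laurent)"
      have b: "?b \<in> carrier ?M" using single_M[OF that C] .
      show ?thesis
        using \<Phi>N[OF rep[of ?b]] \<Phi>_diff[OF rep_M[OF cl_Q[OF b]] b]
        by (simp add: u_def v_def \<Phi>_single)
    qed
    show "frag_extend u (v b) - frag_of b \<in> ?L" if "b \<in> carrier ?A \<times> carrier Q" for b
    proof -
      obtain n q where b: "b = (n, q)" "q \<in> carrier Q"
        using \<open>b \<in> carrier ?A \<times> carrier Q\<close> by auto
      have "frag_extend u (\<Phi> (rep q)) - ?e 1 q \<in> ?L"
        using u\<Phi>[OF rep_M[OF b(2)]] by (simp add: cl_rep b)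
      from L(6)[OF this, of n]
      have "frag_extend u (v b) - frag_cmul n (?e 1 q) \<in> ?L"
      proof -
        assume a: "frag_cmul n (frag_extend u (\<Phi> (rep q)) - ?e 1 q) \<in> ?L"
        have "frag_extend u (v b) - frag_cmul n (?e 1 q)
            = frag_cmul n (frag_extend u (\<Phi> (rep q)) - ?e 1 q)"
          by (rule poly_mapping_eqI)
            (simp add: b v_def frag_extend_cmul lookup_minus right_diff_distrib)
        then show ?thesis using a by simp
      qed
      then show ?thesis using L_trans e_cmul b by blast
    qed
  qed
  then show ?thesis by (simp only: tensor_product_def Q_def N_def \<Phi>_def)
qed

end


section \<open>The arcs at a crossing\<close>

lemma finite_periodic_in_Icc:
  fixes P :: "real \<Rightarrow> bool"
  assumes fin: "finite {t \<in> {0..<1}. P t}" and per: "\<And>t n. P (t + of_int n) \<longleftrightarrow> P t"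
  shows "finite {t \<in> {a..b}. P t}"
proof (rule finite_subset)
  show "{t \<in> {a..b}. P t} \<subseteq> (\<lambda>(t, n). t + of_int n) ` ({t \<in> {0..<1}. P t} \<times> {\<lfloor>a\<rfloor>..\<lfloor>b\<rfloor>})"
  proof
    fix t assume t: "t \<in> {t \<in> {a..b}. P t}"
    have t_eq: "t = frac t + of_int \<lfloor>t\<rfloor>" by (simp add: frac_def)
    have "P (frac t)" using t per[of "frac t" "\<lfloor>t\<rfloor>"] unfolding t_eq[symmetric] by simp
    moreover have "\<lfloor>t\<rfloor> \<in> {\<lfloor>a\<rfloor>..\<lfloor>b\<rfloor>}" using t by (auto intro: floor_mono)
    ultimately have "(frac t, \<lfloor>t\<rfloor>) \<in> {t \<in> {0..<1}. P t} \<times> {\<lfloor>a\<rfloor>..\<lfloor>b\<rfloor>}"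
      using frac_ge_0[of t] frac_lt_1[of t] by simp
    then show "t \<in> (\<lambda>(t, n). t + of_int n) ` ({t \<in> {0..<1}. P t} \<times> {\<lfloor>a\<rfloor>..\<lfloor>b\<rfloor>})"
      by (rule image_eqI[rotated]) (simp add: frac_def)
  qed
qed (use fin in auto)

lemma periodic_add_int:
  fixes f :: "real \<Rightarrow> 'b"
  assumes "\<And>t. f (t + 1) = f t"
  shows "f (t + of_int n) = f t"
proof (induction n rule: int_induct[where k = 0])
  case (step1 i)
  have "t + of_int (i + 1) = t + of_int i + 1" by simp
  then show ?case unfolding step1(2)[symmetric] by (simp only: assms)
next
  case (step2 i)
  have "t + of_int i = t + of_int (i - 1) + 1" by simp
  then show ?case unfolding step2(2)[symmetric] by (simp only: assms)
qed simp

context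
  fixes l :: nat and D :: curves
  assumes diagram: "link_diagram l D"
begin

lemma diagram_periodic:
  assumes "i \<in> {1..l}" shows "D i (t + of_int n) = D i t"
proof (rule periodic_add_int)
  show "D i (t + 1) = D i t" for t
    using diagram assms unfolding link_diagram_def oriented_link_def by blast
qed

lemma undercrossing_periodic:
  assumes "i \<in> {1..l}" shows "undercrossing l D i (t + of_int n) \<longleftrightarrow> undercrossing l D i t"
  by (simp only: undercrossing_def proj_def height_def diagram_periodic[OF assms])

text \<open>
  Over one period every undercrossing lies over one of the finitely many multiple points of the
  projection, and only finitely many parameters lie over each of these.
\<close>

lemma finite_undercrossings:
  assumes j: "j \<in> {1..l}" shows "finite {t \<in> {a..b}. undercrossing l D j t}"
proof (rule finite_periodic_in_Icc)
  define Z where "Z = {z. \<exists>i\<in>{1..l}. \<exists>j\<in>{1..l}. \<exists>s\<in>{0..<1}. \<exists>t\<in>{0..<1}.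
       (i, s) \<noteq> (j, t) \<and> proj D i s = z \<and> proj D j t = z}"
  define fib where "fib z = {(i, t). i \<in> {1..l} \<and> t \<in> {0..<1} \<and> proj D i t = z}" for z
  have fin: "finite Z" "finite (fib z)" for z
    using diagram unfolding link_diagram_def Z_def fib_def by blast+
  have "{t \<in> {0..<1}. undercrossing l D j t} \<subseteq> snd ` (\<Union>z\<in>Z. fib z)"
  proof
    fix t assume "t \<in> {t \<in> {0..<1}. undercrossing l D j t}"
    then obtain i s where t: "t \<in> {0..<1}" and i: "i \<in> {1..l}"
      and s: "proj D i s = proj D j t" "height D i s > height D j t"
      by (auto simp: undercrossing_def)
    have D: "D i (frac s) = D i s"
      using diagram_periodic[OF i, of "frac s" "\<lfloor>s\<rfloor>"] by (simp add: frac_def)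
    have "(i, frac s) \<noteq> (j, t)" using s D by (auto simp: height_def)
    moreover have "proj D i (frac s) = proj D j t" using s D by (simp add: proj_def)
    ultimately have "proj D j t \<in> Z"
      unfolding Z_def using i j t frac_lt_1[of s] frac_ge_0[of s]
      by (intro CollectI bexI[of _ i] bexI[of _ j] bexI[of _ "frac s"] bexI[of _ t]) auto
    then show "t \<in> snd ` (\<Union>z\<in>Z. fib z)" using t j by (force simp: fib_def)
  qed
  then show "finite {t \<in> {0..<1}. undercrossing l D j t}"
    by (rule finite_subset) (intro finite_imageI finite_UN_I fin)
qed (rule undercrossing_periodic[OF j])

text \<open>
  A strand passing above the over-strand of a crossing would be a third strand through the same
  point of the plane, which has at most two.
\<close>

lemma over_strand_not_undercrossing:
  assumes "((i, s), (j, t)) \<in> crossings l D"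
  shows "\<not> undercrossing l D i s"
proof
  assume "undercrossing l D i s"
  have ij: "i \<in> {1..l}" "j \<in> {1..l}" "s \<in> {0..<1}" "t \<in> {0..<1}"
    "proj D i s = proj D j t" "height D i s > height D j t"
    using assms by (auto simp: crossings_def)
  obtain k r where k: "k \<in> {1..l}" "proj D k r = proj D i s" "height D k r > height D i s"
    using \<open>undercrossing l D i s\<close> by (auto simp: undercrossing_def)
  have D: "D k (frac r) = D k r"
    using diagram_periodic[OF k(1), of "frac r" "\<lfloor>r\<rfloor>"] by (simp add: frac_def)
  have k': "proj D k (frac r) = proj D i s" "height D k (frac r) > height D i s"
    using k D by (simp_all add: proj_def height_def)
  define fib where "fib = {(i', t'). i' \<in> {1..l} \<and> t' \<in> {0..<1} \<and> proj D i' t' = proj D i s}"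
  have "finite fib" "card fib \<le> 2" 
    using diagram unfolding link_diagram_def fib_def by blast+
  moreover have "{(i, s), (j, t), (k, frac r)} \<subseteq> fib"
    using ij k k' frac_lt_1[of r] frac_ge_0[of r] by (auto simp: fib_def)
  moreover have "(i, s) \<noteq> (j, t)" "(i, s) \<noteq> (k, frac r)" "(j, t) \<noteq> (k, frac r)"
    using ij(6) k'(2) by auto
  then have "card {(i, s), (j, t), (k, frac r)} = 3" by simp
  ultimately show False using card_mono[of fib "{(i, s), (j, t), (k, frac r)}"] by linarith
qed

lemma segment_shift:
  fixes a b c :: real
  shows "u \<in> closed_segment (a + c) (b + c) \<longleftrightarrow> u - c \<in> closed_segment a b"
  by (auto simp: closed_segment_eq_real_ivl)

text \<open>
  Lying on the same arc is symmetric and transitive: segments without undercrossings can be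
  reversed, moved by whole periods, and joined at a common endpoint.
\<close>

lemma arc_through_eq:
  assumes i: "i \<in> {1..l}" and s: "(i, s) \<in> arc_through l D i t"
  shows "arc_through l D i s = arc_through l D i t"
proof -
  have clear_shift: "(\<forall>u\<in>closed_segment (a + of_int n) (b + of_int n). \<not> undercrossing l D i u)
      \<longleftrightarrow> (\<forall>u\<in>closed_segment a b. \<not> undercrossing l D i u)" for a b and n :: int
    by (metis segment_shift undercrossing_periodic[OF i] diff_add_cancel add_diff_cancel)
  obtain n :: int where n: "\<forall>u\<in>closed_segment t (s + of_int n). \<not> undercrossing l D i u"
    using s by (auto simp: arc_through_def)
  have seg: "closed_segment a c \<subseteq> closed_segment a b \<union> closed_segment b c" for a b c :: real
    by (auto simp: closed_segment_eq_real_ivl)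
  show ?thesis
  proof (intro Set.set_eqI iffI)
    fix p assume "p \<in> arc_through l D i s"
    then obtain r m where p: "p = (i, r)"
      and m: "\<forall>u\<in>closed_segment s (r + of_int m). \<not> undercrossing l D i u"
      by (auto simp: arc_through_def)
    have "\<forall>u\<in>closed_segment (s + of_int n) (r + of_int m + of_int n). \<not> undercrossing l D i u"
      using m by (subst clear_shift)
    then have "\<forall>u\<in>closed_segment t (r + of_int (m + n)). \<not> undercrossing l D i u"
      using n seg[of t "r + of_int (m + n)" "s + of_int n"] by (auto simp: add.assoc)
    then show "p \<in> arc_through l D i t" unfolding p arc_through_def by blast
  next
    fix p assume "p \<in> arc_through l D i t"
    then obtain r m where p: "p = (i, r)"
      and m: "\<forall>u\<in>closed_segment t (r + of_int m). \<not> undercrossing l D i u"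
      by (auto simp: arc_through_def)
    have "\<forall>u\<in>closed_segment (s + of_int n) (r + of_int m). \<not> undercrossing l D i u"
      using n m seg[of "s + of_int n" "r + of_int m" t] by (auto simp: closed_segment_commute)
    then have "\<forall>u\<in>closed_segment (s + of_int n) (r + of_int (m - n) + of_int n). \<not> undercrossing l D i u"
      by simp
    then have "\<forall>u\<in>closed_segment s (r + of_int (m - n)). \<not> undercrossing l D i u"
      by (subst (asm) clear_shift)
    then show "p \<in> arc_through l D i s" unfolding p arc_through_def by blast
  qed
qed

lemma arc_of_point:
  assumes "a \<in> arcs l D" and "(j, u) \<in> a"
  shows "j \<in> {1..l}" "a = arc_through l D j u"
proof -
  obtain i t where a: "i \<in> {1..l}" "a = arc_through l D i t" using assms(1) by (auto simp: arcs_def)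
  then have "j = i" using assms(2) by (auto simp: arc_through_def)
  then show "j \<in> {1..l}" "a = arc_through l D j u" using a arc_through_eq[of i u t] assms(2) by auto
qed

lemma self_in_arc_through:
  assumes "\<not> undercrossing l D i t" shows "(i, t) \<in> arc_through l D i t"
  using assms by (auto simp: arc_through_def intro!: exI[of _ "0 :: int"])

lemma arc_component_in:
  assumes "a \<in> arcs l D" shows "arc_component a \<in> {1..l}"
proof -
  obtain i t where a: "i \<in> {1..l}" "a = arc_through l D i t" "\<not> undercrossing l D i t"
    using assms by (auto simp: arcs_def)
  have "arc_component a = i"
    unfolding arc_component_def
    using self_in_arc_through[OF a(3)] a(2) by (intro the_equality) (auto simp: arc_through_def)
  then show ?thesis using a by simp
qed

text \<open>
  The filter \<open>F\<close> stands for the approach to an undercrossing from either side, \<open>at_left t\<close> or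
  \<open>at_right t\<close>, so that one argument covers both the incoming and the outgoing arc. Any arc met
  within the interval is the arc through its midpoint.
\<close>

lemma arc_along_clear_interval:
  assumes j: "j \<in> {1..l}" and ab: "a < b"
    and clear: "\<And>u. u \<in> {a<..<b} \<Longrightarrow> \<not> undercrossing l D j u"
    and F: "F \<noteq> bot" "\<forall>\<^sub>F u in F. u \<in> {a<..<b}"
  shows "\<exists>!A. A \<in> arcs l D \<and> (\<forall>\<^sub>F u in F. (j, u) \<in> A)"
proof -
  define m where "m = (a + b) / 2"
  have m: "m \<in> {a<..<b}" using ab by (simp add: m_def field_simps)
  have in_arc: "(j, u) \<in> arc_through l D j m" if "u \<in> {a<..<b}" for u
  proof -
    have "closed_segment m (u + of_int 0) \<subseteq> {a<..<b}"
      using m that by (auto simp: closed_segment_eq_real_ivl)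
    then show ?thesis using clear unfolding arc_through_def by blast
  qed
  show ?thesis
  proof (rule ex1I[of _ "arc_through l D j m"])
    have "arc_through l D j m \<in> arcs l D" using j clear[OF m] unfolding arcs_def by blast
    moreover have "\<forall>\<^sub>F u in F. (j, u) \<in> arc_through l D j m"
      using F(2) by (rule eventually_mono) (rule in_arc)
    ultimately show "arc_through l D j m \<in> arcs l D \<and> (\<forall>\<^sub>F u in F. (j, u) \<in> arc_through l D j m)"
      by blast
  next
    fix A assume A: "A \<in> arcs l D \<and> (\<forall>\<^sub>F u in F. (j, u) \<in> A)"
    then have "\<forall>\<^sub>F u in F. (j, u) \<in> A \<and> u \<in> {a<..<b}" using F(2) by (auto intro: eventually_conj)
    then obtain u where u: "(j, u) \<in> A" "u \<in> {a<..<b}"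
      using eventually_happens'[OF F(1)] by blast
    then show "A = arc_through l D j m"
      using arc_of_point(2)[of A j u] A arc_through_eq[OF j in_arc[OF u(2)]] by simp
  qed
qed

text \<open>
  Both arcs are defined as the unique arc with a certain property. Undercrossings being isolated, a
  punctured neighbourhood of \<open>t\<close> is free of them, and its two halves determine the arcs.
\<close>

lemma incoming_outgoing_in_arcs:
  assumes j: "j \<in> {1..l}"
  shows "incoming_arc l D j t \<in> arcs l D" "outgoing_arc l D j t \<in> arcs l D"
proof -
  \<comment> \<open>Removing \<open>t\<close> is essential, as \<open>t\<close> itself usually is an undercrossing.\<close>
  let ?U = "{u \<in> {t - 1..t + 1}. undercrossing l D j u} - {t}"
  have "open (- ?U)"
    by (intro open_Compl finite_imp_closed finite_Diff finite_undercrossings[OF j])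
  then have "\<forall>\<^sub>F u in at t. u \<in> - ?U"
    unfolding eventually_at_topological by (intro exI[of _ "- ?U"]) simp
  then obtain d where d: "d > 0" "\<And>u. u \<noteq> t \<Longrightarrow> dist u t < d \<Longrightarrow> u \<notin> ?U"
    by (auto simp: eventually_at)
  define e where "e = min d 1"
  have e: "e > 0" using d by (simp add: e_def)
  have clear: "\<not> undercrossing l D j u" if "u \<noteq> t" "\<bar>u - t\<bar> < e" for u
    using d(2)[of u] that by (auto simp: e_def dist_real_def)
  have l: "\<exists>!A. A \<in> arcs l D \<and> (\<forall>\<^sub>F u in at_left t. (j, u) \<in> A)"
    by (rule arc_along_clear_interval[OF j, of "t - e" t])
      (use e clear in \<open>auto intro!: eventually_at_leftI[of "t - e"]\<close>)
  have r: "\<exists>!A. A \<in> arcs l D \<and> (\<forall>\<^sub>F u in at_right t. (j, u) \<in> A)"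
    by (rule arc_along_clear_interval[OF j, of t "t + e"])
      (use e clear in \<open>auto intro!: eventually_at_rightI[of _ "t + e"]\<close>)
  show "incoming_arc l D j t \<in> arcs l D" unfolding incoming_arc_def using theI'[OF l] by blast
  show "outgoing_arc l D j t \<in> arcs l D" unfolding outgoing_arc_def using theI'[OF r] by blast
qed

lemma crossing_arcs:
  assumes x: "x \<in> crossings l D"
  shows "over_arc l D x \<in> arcs l D" "source_arc l D x \<in> arcs l D" "target_arc l D x \<in> arcs l D"
proof -
  obtain i s j t where xx: "x = ((i, s), (j, t))" "i \<in> {1..l}" "j \<in> {1..l}"
    using x by (auto simp: crossings_def)
  show "over_arc l D x \<in> arcs l D"
    using over_strand_not_undercrossing[of i s j t] x xx unfolding over_arc_def arcs_def by auto
  show "source_arc l D x \<in> arcs l D" "target_arc l D x \<in> arcs l D"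
    using incoming_outgoing_in_arcs[OF xx(3)] xx(1) by (simp_all add: source_arc_def target_arc_def)
qed

end


section \<open>Specializing the crossing relations\<close>

lemma one_minus_in_laurent_ring:
  assumes "p \<in> carrier (laurent_ring l)"
  shows "1 - p \<in> carrier (laurent_ring l)"
proof -
  have "Poly_Mapping.keys e \<subseteq> {1..l}" if "e \<in> Poly_Mapping.keys (1 - p)" for e
  proof -
    have "e = 0 \<or> e \<in> Poly_Mapping.keys p" using that keys_diff[of 1 p] by auto
    then show ?thesis using assms by (auto simp: laurent_ring_def)
  qed
  then show ?thesis by (simp add: laurent_ring_def)
qed

lemma alexander_relation_in_carrier:
  assumes "link_diagram l D" and "x \<in> crossings l D"
  shows "alexander_relation l D x \<in> carrier (free_laurent_module l (arcs l D))"
proof -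
  have one: "1 \<in> carrier (laurent_ring l)" by (simp add: laurent_ring_def)
  note crossing_arcs[OF assms]
  moreover have "laurent_var (arc_component a) \<in> carrier (laurent_ring l)"
    if "a \<in> arcs l D" for a
    using arc_component_in[OF assms(1) that] by (rule laurent_var_in_carrier)
  ultimately show ?thesis
    unfolding alexander_relation_def Let_def
    by (intro diff_in_free_laurent_module add_in_free_laurent_module single_in_free_laurent_module
      one_minus_in_laurent_ring one) auto
qed

text \<open>
  The coefficient \<open>2 \<epsilon>\<close> of the over-arc is \<open>1 - (-1)^\<epsilon>\<close>, which uses that the type \<open>\<epsilon>\<close> is 0 or 1.
  That all three arcs are arcs of the diagram guarantees that their components have indices in
  \<open>{1..l}\<close>, where \<open>\<phi>\<close> is prescribed on the variables.
\<close>

lemma map_laurent_hom_alexander_relation: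
  assumes diagram: "link_diagram l D" and x: "x \<in> crossings l D"
    and \<tau>: "\<tau> \<in> component_signatures l"
    and \<phi>: "\<phi> \<in> ring_hom (laurent_ring l) int_ring"
    and \<phi>_var: "\<And>k. k \<in> {1..l} \<Longrightarrow> \<phi> (laurent_var k) = (-1) ^ \<tau> k"
  shows "Poly_Mapping.map \<phi> (alexander_relation l D x) = signature_matrix l \<tau> D x"
proof -
  let ?a = "over_arc l D x" and ?b = "source_arc l D x" and ?c = "target_arc l D x"
  let ?i = "arc_component ?b" and ?j = "arc_component ?a"
  let ?M = "free_laurent_module l (arcs l D)"
  note arcs = crossing_arcs[OF diagram x]
  note ij = arc_component_in[OF diagram arcs(2)] arc_component_in[OF diagram arcs(1)]
  have C: "1 \<in> carrier (laurent_ring l)" "1 - laurent_var ?i \<in> carrier (laurent_ring l)"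
    "laurent_var ?i \<in> carrier (laurent_ring l)" "laurent_var ?j \<in> carrier (laurent_ring l)"
    using laurent_var_in_carrier[OF ij(1)] laurent_var_in_carrier[OF ij(2)]
      one_minus_in_laurent_ring[OF laurent_var_in_carrier[OF ij(1)]]
    by (simp_all add: laurent_ring_def)
  have "\<phi> 1 = \<phi> (1 - laurent_var ?i) + \<phi> (laurent_var ?i)"
    using laurent_hom(1)[OF \<phi> C(2,3)] by simp
  then have "\<phi> (1 - laurent_var ?i) = 1 - (-1) ^ \<tau> ?i"
    using \<phi>_var[OF ij(1)] laurent_hom(3)[OF \<phi>] by simp
  also have "\<tau> ?i \<in> {0, 1}" using \<tau> ij(1) by (auto simp: component_signatures_def)
  then have "1 - (-1) ^ \<tau> ?i = 2 * int (\<tau> ?i)" by auto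
  finally have \<phi>_i: "\<phi> (1 - laurent_var ?i) = 2 * int (\<tau> ?i)" .
  note singles = single_in_free_laurent_module[OF arcs(1) C(2)]
    single_in_free_laurent_module[OF arcs(2) C(4)] single_in_free_laurent_module[OF arcs(3) C(1)]
  show ?thesis
    unfolding alexander_relation_def signature_matrix_def Let_def arc_type_def
      map_laurent_hom_diff[OF \<phi> add_in_free_laurent_module[OF singles(1,2)] singles(3)]
      map_laurent_hom_add[OF \<phi> singles(1,2)] map_laurent_hom_single[OF \<phi>]
      \<phi>_i \<phi>_var[OF ij(2)] laurent_hom(3)[OF \<phi>] ..
qed

theorem theorem9p1:
  fixes l :: nat and L D :: curves and \<tau> :: "nat \<Rightarrow> nat" and \<phi> :: "laurent \<Rightarrow> int"
  assumes "oriented_link l L"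
    and "diagram_of l D L"
    and "\<tau> \<in> component_signatures l"
    and "\<phi> \<in> ring_hom (laurent_ring l) int_ring"
    and "\<forall>k\<in>{1..l}. \<phi> (laurent_var k) = (-1) ^ \<tau> k"
  shows "signature_module l \<tau> D \<cong>
           tensor_product (laurent_ring l) (int_module_via \<phi>) (alexander_module l D)"
proof -
  have diagram: "link_diagram l D" using assms(2) by (simp add: diagram_of_def)
  have "Poly_Mapping.map \<phi> ` alexander_relation l D ` crossings l D
      = signature_matrix l \<tau> D ` crossings l D"
    unfolding image_image using assms(3-5)
    by (intro image_cong refl map_laurent_hom_alexander_relation[OF diagram]) auto
  moreover have "alexander_relation l D ` crossings l D \<subseteq> carrier (free_laurent_module l (arcs l D))"
    using alexander_relation_in_carrier[OF diagram] by blast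
  ultimately show ?thesis
    using base_change_presentation[OF assms(4), of "alexander_relation l D ` crossings l D" "arcs l D"]
    by (simp only: signature_module_def alexander_module_def)
qed

end
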